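(* Fix a policy $g:\mathcal{X}\to[J]$ and let $\widehat{\tau}(g)$ be the minimizer of $$\min_{\tau\in[0,1/\eta]}\ \left(\frac1N\sum_{s=1}^N \mathbf{1}\left\{\frac{1}{e(X^s,g(X^s))}>\tau\right\}\right)^2+\frac{2}{N^2}\sum_{s=1}^N\frac{\mathbf{1}\{g(X^s)=D_s\}}{e(X^s,g(X^s))^2}\,\mathbf{1}\left\{\frac{1}{e(X^s,g(X^s))}\le\tau\right\}.$$ Suppose that the sum over any (nonempty) subset of $\{2(C_s)^2\}_{s=1}^N$ is not an integer, where $C_s=1/e(X^s,g(X^s))$. Then $$\widehat{\tau}(g)=\sum_{m=0}^N C_{(m)}\cdot \mathbf{1}_{(0,\infty)}\left(\min_{t\in[N+1],\,t\neq m+1}\Phi_t(g)-\Phi_{m+1}(g)\right).$$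
   Context: $[n]=\{1,\dots,n\}$. The data are $(X^s,D_s)$, $s=1,\dots,N$, with covariates $X^s\in\mathcal{X}\subseteq\mathbb{R}^p$ and treatments $D_s\in[J]$; $e(\xi,j)$ is the known propensity score, i.e. the probability that treatment $j$ is chosen given covariate $\xi$, and $e(\xi,j)\ge\eta>0$ for all $\xi\in\mathcal{X}$, $j\in[J]$. For the given policy $g$, let $C_s=1/e(X^s,g(X^s))$, and sort the samples so that $0=C_{(0)}\le C_{(1)}\le\dots\le C_{(N)}$, where $C_{(0)}=0$ is added by convention and $(X^{(s)},D_{(s)})$ is the sample with the $s$-th smallest value $C_{(s)}$. Let $\varphi_{(s)}(g)=(C_{(s)})^2\,\mathbf{1}\{g(X^{(s)})=D_{(s)}\}$, let $\Phi_m(g)=\sum_{s=m}^N\big(2(N-s)+1-2\varphi_{(s)}(g)\big)$ for $m=1,\dots,N$, and $\Phi_{N+1}(g)=0$. The objective is piecewise constant in $\tau$ with jumps only at the values $C_{(s)}$; "the minimizer" $\widehat\tau(g)$ means the minimizer taken among the values $C_{(0)},\dots,C_{(N)}$. $\mathbf{1}_{(0,\infty)}(t)=1$ if $t>0$ and $0$ otherwise.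
   Formalization: The values C_1,…,C_N are assumed pairwise distinct; with ties the claim as printed fails, e.g. N=2, C_1=C_2=√1.15 and g(X^s)=D_s for both samples, where the minimizer is 0 but the formula returns √1.15. *)

theory Defs
  imports "HOL-Analysis.Analysis"
begin

text \<open>
  Samples are indexed by \<open>s \<in> {1..N}\<close> and treatments by \<open>{1..J}\<close>; values of \<open>X\<close>, \<open>D\<close>, \<open>e\<close>, \<open>g\<close>
  outside these ranges (and outside the covariate space) play no role.
\<close>

definition inv_prop :: "('x \<Rightarrow> nat \<Rightarrow> real) \<Rightarrow> ('x \<Rightarrow> nat) \<Rightarrow> (nat \<Rightarrow> 'x) \<Rightarrow> nat \<Rightarrow> real" where
  "inv_prop e g X s = 1 / e (X s) (g (X s))"

definition objective ::
  "('x \<Rightarrow> nat \<Rightarrow> real) \<Rightarrow> ('x \<Rightarrow> nat) \<Rightarrow> (nat \<Rightarrow> 'x) \<Rightarrow> (nat \<Rightarrow> nat) \<Rightarrow> nat \<Rightarrow> real \<Rightarrow> real" where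
  "objective e g X D N \<tau> =
     (1 / real N * (\<Sum>s=1..N. of_bool (1 / e (X s) (g (X s)) > \<tau>)))\<^sup>2
     + 2 / (real N)\<^sup>2 *
       (\<Sum>s=1..N. of_bool (g (X s) = D s) / (e (X s) (g (X s)))\<^sup>2
                    * of_bool (1 / e (X s) (g (X s)) \<le> \<tau>))"

text \<open>
  The objective is constant between consecutive jumps, so its minimizers over \<open>[0, 1/\<eta>]\<close> form
  intervals; the minimizer of interest is the one among \<open>0\<close> and the jump points.
\<close>

definition is_threshold_minimizer ::
  "('x \<Rightarrow> nat \<Rightarrow> real) \<Rightarrow> ('x \<Rightarrow> nat) \<Rightarrow> (nat \<Rightarrow> 'x) \<Rightarrow> (nat \<Rightarrow> nat) \<Rightarrow> nat \<Rightarrow> real \<Rightarrow> real \<Rightarrow> bool" where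
  "is_threshold_minimizer e g X D N \<eta> \<tau> \<longleftrightarrow>
     is_arg_min (objective e g X D N) (\<lambda>t. t \<in> {0..1 / \<eta>}) \<tau> \<and>
     \<tau> \<in> insert 0 (inv_prop e g X ` {1..N})"

definition tau_hat ::
  "('x \<Rightarrow> nat \<Rightarrow> real) \<Rightarrow> ('x \<Rightarrow> nat) \<Rightarrow> (nat \<Rightarrow> 'x) \<Rightarrow> (nat \<Rightarrow> nat) \<Rightarrow> nat \<Rightarrow> real \<Rightarrow> real" where
  "tau_hat e g X D N \<eta> = (THE \<tau>. is_threshold_minimizer e g X D N \<eta> \<tau>)"

text \<open>
  A sorting of the samples is a permutation \<open>\<sigma>\<close> of \<open>{1..N}\<close>: \<open>\<sigma> s\<close> is the index of the sample with
  the \<open>s\<close>-th smallest inverse propensity, i.e. \<open>X (\<sigma> s)\<close> is \<open>X\<^sup>(\<^sup>s\<^sup>)\<close>.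
\<close>

definition sorts_samples :: "(nat \<Rightarrow> real) \<Rightarrow> nat \<Rightarrow> (nat \<Rightarrow> nat) \<Rightarrow> bool" where
  "sorts_samples C N \<sigma> \<longleftrightarrow> bij_betw \<sigma> {1..N} {1..N} \<and> mono_on {1..N} (\<lambda>s. C (\<sigma> s))"

definition ordered_inv_prop ::
  "('x \<Rightarrow> nat \<Rightarrow> real) \<Rightarrow> ('x \<Rightarrow> nat) \<Rightarrow> (nat \<Rightarrow> 'x) \<Rightarrow> (nat \<Rightarrow> nat) \<Rightarrow> nat \<Rightarrow> real" where
  "ordered_inv_prop e g X \<sigma> s = (if s = 0 then 0 else inv_prop e g X (\<sigma> s))"

definition ordered_phi ::
  "('x \<Rightarrow> nat \<Rightarrow> real) \<Rightarrow> ('x \<Rightarrow> nat) \<Rightarrow> (nat \<Rightarrow> 'x) \<Rightarrow> (nat \<Rightarrow> nat) \<Rightarrow> (nat \<Rightarrow> nat) \<Rightarrow> nat \<Rightarrow> real" where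
  "ordered_phi e g X D \<sigma> s = (ordered_inv_prop e g X \<sigma> s)\<^sup>2 * of_bool (g (X (\<sigma> s)) = D (\<sigma> s))"

text \<open>For \<open>m = N + 1\<close> the sum below is empty, hence \<open>0\<close>.\<close>

definition Phi ::
  "('x \<Rightarrow> nat \<Rightarrow> real) \<Rightarrow> ('x \<Rightarrow> nat) \<Rightarrow> (nat \<Rightarrow> 'x) \<Rightarrow> (nat \<Rightarrow> nat) \<Rightarrow> nat \<Rightarrow> (nat \<Rightarrow> nat) \<Rightarrow> nat \<Rightarrow> real" where
  "Phi e g X D N \<sigma> m =
     (\<Sum>s=m..N. 2 * (real N - real s) + 1 - 2 * ordered_phi e g X D \<sigma> s)"

end

theory Submission
  imports Defs
begin

text \<open>
  Evaluate the objective at the \<open>m\<close>-th sorted value \<open>C\<^bsub>(m)\<^esub>\<close>. The values are distinct, so \<open>N - m\<close> samples lie above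
  that threshold, and \<open>(N - m)\<^sup>2\<close> is the sum of the odd numbers \<open>2 (N - s) + 1\<close> over \<open>m < s \<le> N\<close>.
  The penalty over the samples \<open>s \<le> m\<close> is the total penalty less the one over \<open>s > m\<close>. Hence
  \<open>N\<^sup>2\<close> times the objective is \<open>\<Phi>\<^bsub>m+1\<^esub>\<close> plus a constant that does not depend on \<open>m\<close>
  (\<open>objective_eq_Phi\<close>), and minimizing over thresholds means minimizing \<open>\<Phi>\<close> over \<open>{1..N+1}\<close>.

  The minimizer is unique because \<open>\<Phi>\<close> takes pairwise different values (\<open>inj_on_Phi\<close>): a difference
  of two values is a positive integer minus a sum of some of the \<open>2 C\<^sub>s\<^sup>2\<close>. This cannot vanish,
  since that sum is either empty or not an integer. The indicator in the closed formula is therefore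
  \<open>1\<close> exactly at the index of the minimizer, and the sum returns the corresponding \<open>C\<^bsub>(m)\<^esub>\<close>
  (\<open>sum_strict_minimizer\<close>).
\<close>

lemma sum_odd_tail:
  fixes m N :: nat
  assumes "m \<le> N"
  shows "(\<Sum>s=m+1..N. 2 * (real N - real s) + 1) = (real N - real m)\<^sup>2"
  using assms
proof (induction m rule: inc_induct)
  case base
  show ?case by simp
next
  case (step n)
  have "{n+1..N} = insert (n+1) {n+1+1..N}" using step.hyps by auto
  then show ?case
    using step.IH by (simp add: power2_eq_square algebra_simps)
qed

text \<open>
  The term of index \<open>m\<close> survives only if \<open>F (m+1)\<close> is strictly below all other values of \<open>F\<close>, so
  the sum reads off \<open>c\<close> at the strict minimizer.
\<close>

lemma sum_strict_minimizer:
  fixes F c :: "nat \<Rightarrow> real"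
  assumes k: "k \<le> N" and min: "\<And>t. t \<in> {1..N+1} \<Longrightarrow> t \<noteq> k + 1 \<Longrightarrow> F (k+1) < F t"
    and N: "N \<ge> 1"
  shows "(\<Sum>m=0..N. c m * indicat_real {0<..} (Min (F ` ({1..N+1} - {m+1})) - F (m+1))) = c k"
proof -
  have ind: "indicat_real {0<..} (Min (F ` ({1..N+1} - {m+1})) - F (m+1)) = of_bool (m = k)"
    if m: "m \<in> {0..N}" for m
  proof (cases "m = k")
    case True
    have "(if k = 0 then 2 else 1) \<in> {1..N+1} - {k+1}" using N by auto
    then have "F ` ({1..N+1} - {k+1}) \<noteq> {}" by blast
    then have "F (k+1) < Min (F ` ({1..N+1} - {k+1}))"
      using min by (subst Min_gr_iff) auto
    then show ?thesis using True by simp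
  next
    case False
    have "Min (F ` ({1..N+1} - {m+1})) \<le> F (k+1)"
      using k False by (intro Min_le) auto
    also have "\<dots> < F (m+1)" using m False by (intro min) auto
    finally show ?thesis using False by simp
  qed
  have "(\<Sum>m=0..N. c m * indicat_real {0<..} (Min (F ` ({1..N+1} - {m+1})) - F (m+1)))
      = (\<Sum>m=0..N. if m = k then c m else 0)"
    by (intro sum.cong refl, subst ind) auto
  then show ?thesis using k by simp
qed

lemma strict_mono_on_ordered_inv_prop:
  assumes pos: "\<And>s. s \<in> {1..N} \<Longrightarrow> inv_prop e g X s > 0"
    and sorting: "sorts_samples (inv_prop e g X) N \<sigma>"
    and inj: "inj_on (inv_prop e g X) {1..N}"
  shows "strict_mono_on {0..N} (ordered_inv_prop e g X \<sigma>)"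
proof (rule strict_mono_onI)
  fix r s assume rs: "r \<in> {0..N}" "s \<in> {0..N}" "r < s"
  have bij: "bij_betw \<sigma> {1..N} {1..N}"
    and mono: "mono_on {1..N} (\<lambda>s. inv_prop e g X (\<sigma> s))"
    using sorting by (auto simp: sorts_samples_def)
  show "ordered_inv_prop e g X \<sigma> r < ordered_inv_prop e g X \<sigma> s"
  proof (cases "r = 0")
    case True
    then show ?thesis
      using rs pos bij_betwE[OF bij] by (auto simp: ordered_inv_prop_def)
  next
    case False
    then have r: "r \<in> {1..N}" and s: "s \<in> {1..N}" using rs by auto
    have "inv_prop e g X (\<sigma> r) \<le> inv_prop e g X (\<sigma> s)"
      using mono_onD[OF mono r s] rs by simp
    moreover have "inv_prop e g X (\<sigma> r) \<noteq> inv_prop e g X (\<sigma> s)"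
      using inj bij r s rs bij_betwE[OF bij]
      by (metis bij_betw_imp_inj_on inj_on_contraD less_irrefl)
    ultimately show ?thesis using False rs by (auto simp: ordered_inv_prop_def)
  qed
qed

text \<open>
  Only the position \<open>m\<close> of the threshold among the sorted values matters, which is also why the
  objective is constant between consecutive sorted values. The sums over the samples are first
  reindexed by the sorting permutation.
\<close>

lemma objective_eq_Phi:
  assumes bij: "bij_betw \<sigma> {1..N} {1..N}" and N: "N \<ge> 1" and m: "m \<le> N"
    and below: "\<And>s. s \<in> {1..m} \<Longrightarrow> ordered_inv_prop e g X \<sigma> s \<le> \<tau>"
    and above: "\<And>s. s \<in> {m+1..N} \<Longrightarrow> \<tau> < ordered_inv_prop e g X \<sigma> s"
  shows "(real N)\<^sup>2 * objective e g X D N \<tau>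
    = Phi e g X D N \<sigma> (m+1) + 2 * (\<Sum>s=1..N. ordered_phi e g X D \<sigma> s)"
proof -
  let ?c = "ordered_inv_prop e g X \<sigma>" and ?p = "ordered_phi e g X D \<sigma>"
  have split: "{1..N} = {1..m} \<union> {m+1..N}" using m by auto
  have split_sum: "(\<Sum>s=1..N. f s) = (\<Sum>s=1..m. f s) + (\<Sum>s=m+1..N. f s)" for f :: "nat \<Rightarrow> real"
    by (subst split, rule sum.union_disjoint) auto
  have "(\<Sum>s=1..N. of_bool (1 / e (X s) (g (X s)) > \<tau>))
      = (\<Sum>s=1..N. of_bool (1 / e (X (\<sigma> s)) (g (X (\<sigma> s))) > \<tau>) :: real)"
    by (rule sum.reindex_bij_betw[OF bij, symmetric])
  also have "\<dots> = (\<Sum>s=1..N. of_bool (?c s > \<tau>))"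
    by (intro sum.cong refl) (auto simp: ordered_inv_prop_def inv_prop_def)
  also have "\<dots> = (\<Sum>s=1..m. 0) + (\<Sum>s=m+1..N. 1)"
    unfolding split_sum using below above
    by (intro arg_cong2[where f = "(+)"] sum.cong refl) (auto simp: not_less)
  finally have count: "(\<Sum>s=1..N. of_bool (1 / e (X s) (g (X s)) > \<tau>)) = real N - real m"
    using m by simp
  have "(\<Sum>s=1..N. of_bool (g (X s) = D s) / (e (X s) (g (X s)))\<^sup>2
                    * of_bool (1 / e (X s) (g (X s)) \<le> \<tau>))
      = (\<Sum>s=1..N. of_bool (g (X (\<sigma> s)) = D (\<sigma> s)) / (e (X (\<sigma> s)) (g (X (\<sigma> s))))\<^sup>2
                    * of_bool (1 / e (X (\<sigma> s)) (g (X (\<sigma> s))) \<le> \<tau>))"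
    by (rule sum.reindex_bij_betw[OF bij, symmetric])
  also have "\<dots> = (\<Sum>s=1..N. ?p s * of_bool (?c s \<le> \<tau>))"
    by (intro sum.cong refl)
       (auto simp: ordered_phi_def ordered_inv_prop_def inv_prop_def power_divide)
  also have "\<dots> = (\<Sum>s=1..m. ?p s) + (\<Sum>s=m+1..N. 0)"
    unfolding split_sum using below above
    by (intro arg_cong2[where f = "(+)"] sum.cong refl) (auto simp: not_le)
  finally have penalty: "(\<Sum>s=1..N. of_bool (g (X s) = D s) / (e (X s) (g (X s)))\<^sup>2
                    * of_bool (1 / e (X s) (g (X s)) \<le> \<tau>)) = (\<Sum>s=1..m. ?p s)"
    by simp
  have "(real N)\<^sup>2 * objective e g X D N \<tau> = (real N - real m)\<^sup>2 + 2 * (\<Sum>s=1..m. ?p s)"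
    unfolding objective_def count penalty
    using N by (simp add: field_simps)
  moreover have "Phi e g X D N \<sigma> (m+1) = (real N - real m)\<^sup>2 - 2 * (\<Sum>s=m+1..N. ?p s)"
    unfolding Phi_def sum_subtractf sum_odd_tail[OF m] by (simp add: sum_distrib_left)
  ultimately show ?thesis using split_sum[of ?p] by linarith
qed

text \<open>
  For \<open>a < b\<close> an equality \<open>\<Phi>\<^sub>a = \<Phi>\<^sub>b\<close> would equate the positive integer
  \<open>\<Sum>\<^bsub>a\<le>s<b\<^esub> (2 (N - s) + 1)\<close> with the sum of \<open>2 C\<^sub>s\<^sup>2\<close> over those samples in between whose treatment
  agrees with the policy. An empty set of such samples contradicts positivity, a nonempty one
  contradicts the non-integrality assumption.
\<close>

lemma inj_on_Phi:
  assumes bij: "bij_betw \<sigma> {1..N} {1..N}"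
    and non_integer:
      "\<And>S. S \<subseteq> {1..N} \<Longrightarrow> S \<noteq> {} \<Longrightarrow> (\<Sum>s\<in>S. 2 * (inv_prop e g X s)\<^sup>2) \<notin> \<int>"
  shows "inj_on (Phi e g X D N \<sigma>) {1..N+1}"
proof (rule linorder_inj_onI)
  fix a b assume ab: "a < b" "a \<in> {1..N+1}" "b \<in> {1..N+1}"
  define T where "T = {s \<in> {a..<b}. g (X (\<sigma> s)) = D (\<sigma> s)}"
  define n where "n = (\<Sum>s=a..<b. 2 * (real N - real s) + 1)"
  have T_sub: "T \<subseteq> {1..N}" using ab by (auto simp: T_def)
  have "{a..N} = {a..<b} \<union> {b..N}" using ab by auto
  then have "Phi e g X D N \<sigma> a
      = (\<Sum>s=a..<b. 2 * (real N - real s) + 1 - 2 * ordered_phi e g X D \<sigma> s) + Phi e g X D N \<sigma> b"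
    unfolding Phi_def by (simp only:, intro sum.union_disjoint) auto
  also have "(\<Sum>s=a..<b. 2 * (real N - real s) + 1 - 2 * ordered_phi e g X D \<sigma> s)
      = n - (\<Sum>s=a..<b. 2 * ordered_phi e g X D \<sigma> s)"
    by (simp add: n_def sum_subtractf)
  also have "(\<Sum>s=a..<b. 2 * ordered_phi e g X D \<sigma> s) = (\<Sum>s\<in>T. 2 * (inv_prop e g X (\<sigma> s))\<^sup>2)"
    using ab by (intro sum.mono_neutral_cong_right)
                (auto simp: T_def ordered_phi_def ordered_inv_prop_def)
  also have "\<dots> = (\<Sum>s\<in>\<sigma> ` T. 2 * (inv_prop e g X s)\<^sup>2)"
    using inj_on_subset[OF bij_betw_imp_inj_on[OF bij] T_sub] by (simp add: sum.reindex)
  finally have diff: "Phi e g X D N \<sigma> a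
      = n - (\<Sum>s\<in>\<sigma> ` T. 2 * (inv_prop e g X s)\<^sup>2) + Phi e g X D N \<sigma> b" .
  have n_int: "n \<in> \<int>" unfolding n_def by (intro Ints_sum Ints_add Ints_mult Ints_diff) auto
  have n_pos: "n > 0" unfolding n_def using ab by (intro sum_pos) auto
  show "Phi e g X D N \<sigma> a \<noteq> Phi e g X D N \<sigma> b"
  proof
    assume eq: "Phi e g X D N \<sigma> a = Phi e g X D N \<sigma> b"
    then have sum_eq: "(\<Sum>s\<in>\<sigma> ` T. 2 * (inv_prop e g X s)\<^sup>2) = n" using diff by simp
    have "\<sigma> ` T \<noteq> {}" using sum_eq n_pos by auto
    moreover have "\<sigma> ` T \<subseteq> {1..N}" using T_sub bij_betwE[OF bij] by auto
    ultimately show False using non_integer[of "\<sigma> ` T"] sum_eq n_int by simp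
  qed
qed auto

theorem proposition3:
  fixes \<X> :: "(real ^ 'p) set"
    and e :: "real ^ 'p \<Rightarrow> nat \<Rightarrow> real"
    and g :: "real ^ 'p \<Rightarrow> nat"
    and X :: "nat \<Rightarrow> real ^ 'p"
    and D \<sigma> :: "nat \<Rightarrow> nat"
    and N J :: nat
    and \<eta> :: real
  assumes N_pos: "N \<ge> 1"
    and eta_pos: "\<eta> > 0"
    and e_lower: "\<And>\<xi> j. \<xi> \<in> \<X> \<Longrightarrow> j \<in> {1..J} \<Longrightarrow> e \<xi> j \<ge> \<eta>"
    and e_prob: "\<And>\<xi>. \<xi> \<in> \<X> \<Longrightarrow> (\<Sum>j=1..J. e \<xi> j) = 1"
    and X_in: "\<And>s. s \<in> {1..N} \<Longrightarrow> X s \<in> \<X>"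
    and D_in: "\<And>s. s \<in> {1..N} \<Longrightarrow> D s \<in> {1..J}"
    and policy: "g \<in> \<X> \<rightarrow> {1..J}"
    and sorting: "sorts_samples (inv_prop e g X) N \<sigma>"
    and no_ties: "inj_on (inv_prop e g X) {1..N}"
    and non_integer: "\<And>S. S \<subseteq> {1..N} \<Longrightarrow> S \<noteq> {} \<Longrightarrow> (\<Sum>s\<in>S. 2 * (inv_prop e g X s)\<^sup>2) \<notin> \<int>"
  shows "(\<exists>!\<tau>. is_threshold_minimizer e g X D N \<eta> \<tau>) \<and>
    tau_hat e g X D N \<eta> =
      (\<Sum>m=0..N. ordered_inv_prop e g X \<sigma> m *
         indicat_real {0<..}
           (Min (Phi e g X D N \<sigma> ` ({1..N+1} - {m+1})) - Phi e g X D N \<sigma> (m+1)))"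
proof -
  let ?c = "ordered_inv_prop e g X \<sigma>" and ?\<Phi> = "Phi e g X D N \<sigma>" and ?f = "objective e g X D N"
  let ?K = "2 * (\<Sum>s=1..N. ordered_phi e g X D \<sigma> s)"
  have bij: "bij_betw \<sigma> {1..N} {1..N}" using sorting by (simp add: sorts_samples_def)
  have C_bounds: "0 < inv_prop e g X s \<and> inv_prop e g X s \<le> 1 / \<eta>" if "s \<in> {1..N}" for s
  proof -
    have "g (X s) \<in> {1..J}" using policy X_in[OF that] by blast
    then have "\<eta> \<le> e (X s) (g (X s))" by (rule e_lower[OF X_in[OF that]])
    then show ?thesis using eta_pos by (auto simp: inv_prop_def intro!: divide_left_mono)
  qed
  have c_strict: "strict_mono_on {0..N} ?c"
    using C_bounds sorting no_ties by (intro strict_mono_on_ordered_inv_prop) auto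
  have c_mono: "?c r \<le> ?c s" if "r \<le> s" "s \<le> N" for r s
    using strict_mono_on_leD[OF c_strict, of r s] that by simp
  have c_0: "?c 0 = 0" by (simp add: ordered_inv_prop_def)
  have c_range: "?c m \<in> {0..1 / \<eta>}" if "m \<le> N" for m
    using that eta_pos C_bounds[of "\<sigma> m"] bij_betwE[OF bij]
    by (auto simp: ordered_inv_prop_def)
  have candidates: "insert 0 (inv_prop e g X ` {1..N}) = ?c ` {0..N}"
  proof -
    have "inv_prop e g X ` {1..N} = (\<lambda>s. inv_prop e g X (\<sigma> s)) ` {1..N}"
      using bij_betw_imp_surj_on[OF bij] by (metis image_image)
    also have "\<dots> = ?c ` {1..N}" by (intro image_cong) (auto simp: ordered_inv_prop_def)
    finally have "insert 0 (inv_prop e g X ` {1..N}) = ?c ` insert 0 {1..N}"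
      using c_0 by simp
    also have "insert 0 {1..N} = {0..N}" by auto
    finally show ?thesis .
  qed
  have f_c: "(real N)\<^sup>2 * ?f (?c m) = ?\<Phi> (m+1) + ?K" if "m \<le> N" for m
    using that c_mono strict_mono_onD[OF c_strict]
    by (intro objective_eq_Phi bij N_pos) auto
  \<comment> \<open>Any threshold performs like the largest sorted value that does not exceed it.\<close>
  have f_reduce: "\<exists>m\<le>N. (real N)\<^sup>2 * ?f t = ?\<Phi> (m+1) + ?K" if "0 \<le> t" for t
  proof -
    define m where "m = Max {m. m \<le> N \<and> ?c m \<le> t}"
    have fin: "finite {m. m \<le> N \<and> ?c m \<le> t}" by simp
    have "{m. m \<le> N \<and> ?c m \<le> t} \<noteq> {}" using that c_0 by auto
    then have m: "m \<le> N" "?c m \<le> t" using Max_in[OF fin] unfolding m_def by auto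
    have "t < ?c s" if "s \<in> {m+1..N}" for s
    proof (rule ccontr)
      assume "\<not> t < ?c s"
      then have "s \<le> m" using that unfolding m_def by (intro Max_ge[OF fin]) auto
      then show False using that by simp
    qed
    moreover have "?c s \<le> t" if "s \<in> {1..m}" for s
      using c_mono[of s m] that m by simp
    ultimately show ?thesis
      using m by (intro exI[of _ m] conjI objective_eq_Phi bij N_pos) auto
  qed
  have Phi_inj: "inj_on ?\<Phi> {1..N+1}" using bij non_integer by (rule inj_on_Phi)
  obtain k where k: "k \<le> N" and k_min: "\<And>m. m \<le> N \<Longrightarrow> m \<noteq> k \<Longrightarrow> ?\<Phi> (k+1) < ?\<Phi> (m+1)"
  proof -
    obtain k where k: "is_arg_min (\<lambda>m. ?\<Phi> (m+1)) (\<lambda>m. m \<in> {0..N}) k"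
      using ex_is_arg_min_if_finite[of "{0..N}" "\<lambda>m. ?\<Phi> (m+1)"] by auto
    show ?thesis
    proof (rule that[of k])
      show "k \<le> N" using k by (simp add: is_arg_min_def)
      fix m assume "m \<le> N" "m \<noteq> k"
      moreover from this have "?\<Phi> (m+1) \<noteq> ?\<Phi> (k+1)"
        using inj_onD[OF Phi_inj, of "m+1" "k+1"] \<open>k \<le> N\<close> by auto
      ultimately show "?\<Phi> (k+1) < ?\<Phi> (m+1)"
        using k by (force simp: is_arg_min_linorder)
    qed
  qed
  have N2: "(real N)\<^sup>2 > 0" using N_pos by simp
  have minimizer_k: "is_threshold_minimizer e g X D N \<eta> (?c k)"
  proof -
    have "?f (?c k) \<le> ?f t" if t: "t \<in> {0..1 / \<eta>}" for t
    proof -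
      obtain m where m: "m \<le> N" "(real N)\<^sup>2 * ?f t = ?\<Phi> (m+1) + ?K"
        using f_reduce[of t] t by auto
      have "?\<Phi> (k+1) \<le> ?\<Phi> (m+1)" using k_min[OF m(1)] by (cases "m = k") auto
      then have "(real N)\<^sup>2 * ?f (?c k) \<le> (real N)\<^sup>2 * ?f t"
        using m f_c[OF k] by simp
      then show ?thesis using N2 by (simp only: mult_le_cancel_left_pos)
    qed
    then show ?thesis
      using c_range[OF k] k
      unfolding is_threshold_minimizer_def is_arg_min_linorder candidates by auto
  qed
  have minimizer_unique: "\<tau> = ?c k" if \<tau>: "is_threshold_minimizer e g X D N \<eta> \<tau>" for \<tau>
  proof -
    obtain m where m: "m \<le> N" "\<tau> = ?c m"
      using \<tau> unfolding is_threshold_minimizer_def candidates by auto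
    have "?f (?c m) \<le> ?f (?c k)"
      using \<tau> m c_range[OF k] unfolding is_threshold_minimizer_def is_arg_min_linorder by auto
    then have "(real N)\<^sup>2 * ?f (?c m) \<le> (real N)\<^sup>2 * ?f (?c k)"
      using N2 by (simp only: mult_le_cancel_left_pos)
    then have "?\<Phi> (m+1) \<le> ?\<Phi> (k+1)" using f_c[OF k] f_c[OF m(1)] by simp
    then have "m = k" using k_min[OF m(1)] by fastforce
    then show ?thesis using m by simp
  qed
  have "tau_hat e g X D N \<eta> = ?c k"
    unfolding tau_hat_def using minimizer_k minimizer_unique by (rule the_equality)
  moreover have "?c k = (\<Sum>m=0..N. ?c m *
      indicat_real {0<..} (Min (?\<Phi> ` ({1..N+1} - {m+1})) - ?\<Phi> (m+1)))"
  proof (rule sum_strict_minimizer[symmetric, OF k _ N_pos])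
    fix t assume "t \<in> {1..N+1}" "t \<noteq> k + 1"
    then show "?\<Phi> (k+1) < ?\<Phi> t" using k_min[of "t - 1"] by auto
  qed
  ultimately have "tau_hat e g X D N \<eta> = (\<Sum>m=0..N. ?c m *
      indicat_real {0<..} (Min (?\<Phi> ` ({1..N+1} - {m+1})) - ?\<Phi> (m+1)))"
    by (rule trans)
  moreover have "\<exists>!\<tau>. is_threshold_minimizer e g X D N \<eta> \<tau>"
    using minimizer_k minimizer_unique by (rule ex1I)
  ultimately show ?thesis by (intro conjI)
qed

end
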